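(* Let $q\ge 1$ be an integer. Then both sequences $(k_{q,m})_{m\ge 2}$ and $(b_{q,m})_{m\ge 2}$ are strictly increasing in $m$, where $k_{q,m},b_{q,m}$ are the real numbers determined by $M_{\beta_{q,m}}(\alpha)=k_{q,m}\,\alpha+b_{q,m}$ for all $\alpha\in[0,1-\langle\beta_{q,m}\rangle)$.
   Context: For a real number $r$, $\lfloor r\rfloor$ is its integer part and $\langle r\rangle=r-\lfloor r\rfloor$; $\lambda$ is Lebesgue measure. For integers $q\ge 1$, $m\ge 2$, $\beta_{q,m}$ is the unique real root in $(q,q+1)$ of $x^m=q x^{m-1}+q x^{m-2}+\cdots+q$. For $\beta>1$ and $\alpha\in[0,1)$, let $T_{\beta,\alpha}:[0,1]\to[0,1]$, $T_{\beta,\alpha}(x)=\beta x+\alpha-\lfloor\beta x+\alpha\rfloor$, with iterates $T_{\beta,\alpha}^n$ ($T_{\beta,\alpha}^0$ the identity). Define, for $x\in[0,1]$, $$\tilde g_{\beta,\alpha}(x)=\sum_{n\ge 0:\ x<T_{\beta,\alpha}^n(1)}\frac{1}{\beta^n}-\sum_{n\ge 0:\ x<T_{\beta,\alpha}^n(0)}\frac{1}{\beta^n},\qquad g_{\beta,\alpha}(x)=\frac{\tilde g_{\beta,\alpha}(x)}{\int_{[0,1]}\tilde g_{\beta,\alpha}\,d\lambda},$$ and $M_\beta(\alpha)=\int_{[0,1]}x\,g_{\beta,\alpha}(x)\,d\lambda(x)$. It is known that for $q\ge1$, $m\ge2$ the function $M_{\beta_{q,m}}$ is affine on $[0,1-\langle\beta_{q,m}\rangle)$,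 so $k_{q,m}$ and $b_{q,m}$ are well defined. *)

theory Defs
  imports "HOL-Analysis.Analysis"
begin

definition beta_qm :: "nat \<Rightarrow> nat \<Rightarrow> real" where
  "beta_qm q m =
     (THE x. real q < x \<and> x < real q + 1 \<and> x ^ m = (\<Sum>i<m. real q * x ^ i))"

text \<open>The map is only ever applied to points of \<open>[0,1]\<close>, which it maps into \<open>[0,1)\<close>.\<close>

definition T :: "real \<Rightarrow> real \<Rightarrow> real \<Rightarrow> real" where
  "T \<beta> \<alpha> x = \<beta> * x + \<alpha> - of_int \<lfloor>\<beta> * x + \<alpha>\<rfloor>"

definition g_tilde :: "real \<Rightarrow> real \<Rightarrow> real \<Rightarrow> real" where
  "g_tilde \<beta> \<alpha> x =
     (\<Sum>n. if x < (T \<beta> \<alpha> ^^ n) 1 then 1 / \<beta> ^ n else 0)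
   - (\<Sum>n. if x < (T \<beta> \<alpha> ^^ n) 0 then 1 / \<beta> ^ n else 0)"

definition g :: "real \<Rightarrow> real \<Rightarrow> real \<Rightarrow> real" where
  "g \<beta> \<alpha> x = g_tilde \<beta> \<alpha> x / (LINT y:{0..1}|lebesgue. g_tilde \<beta> \<alpha> y)"

definition M :: "real \<Rightarrow> real \<Rightarrow> real" where
  "M \<beta> \<alpha> = (LINT x:{0..1}|lebesgue. x * g \<beta> \<alpha> x)"

text \<open>The pair (slope, intercept) of \<open>M (beta_qm q m)\<close> on
  \<open>[0, 1 - frac (beta_qm q m))\<close>. It is unique because this interval is nondegenerate, and it
  exists because \<open>M (beta_qm q m)\<close> is affine there when \<open>q \<ge> 1\<close> and \<open>m \<ge> 2\<close>.\<close>

definition affine_coeffs :: "nat \<Rightarrow> nat \<Rightarrow> real \<times> real" where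
  "affine_coeffs q m =
     (THE (k, b). \<forall>\<alpha>\<in>{0..<1 - frac (beta_qm q m)}. M (beta_qm q m) \<alpha> = k * \<alpha> + b)"

definition k_qm :: "nat \<Rightarrow> nat \<Rightarrow> real" where
  "k_qm q m = fst (affine_coeffs q m)"

definition b_qm :: "nat \<Rightarrow> nat \<Rightarrow> real" where
  "b_qm q m = snd (affine_coeffs q m)"

end

theory Submission
  imports Defs
begin

text \<open>
  Write \<open>\<beta>\<close> for the root, \<open>\<epsilon> = 1 / \<beta>\<^sup>m\<close>, \<open>\<delta> = 1 - frac \<beta>\<close> and
  \<open>s\<^sub>n = 1 + \<beta> + \<dots> + \<beta>\<^bsup>n-1\<^esup>\<close>. The defining equation of \<open>\<beta>\<close> says \<open>\<delta> = q\<epsilon>\<close> and \<open>\<delta> s\<^sub>m = 1\<close>.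

  The slope and the intercept can be computed because the orbits of 0 and 1 meet after exactly
  \<open>m\<close> steps. For \<open>0 \<le> \<alpha> < \<delta>\<close> the orbit of 0 never wraps around during the first \<open>m\<close> steps,
  the orbit of 1 always loses exactly \<open>q\<close>, and so \<open>T\<^sup>n 0 = \<alpha> s\<^sub>n\<close> and
  \<open>T\<^sup>n 1 = 1 - (\<delta> - \<alpha>) s\<^sub>n\<close>; at \<open>n = m\<close> both equal \<open>\<alpha> s\<^sub>m\<close> (\<open>orbits\<close>, \<open>orbits_merge\<close>).
  The unnormalised density is therefore a combination of the indicators of \<open>m\<close> intervals whose
  lengths \<open>d\<^sub>n = 1 - \<delta> s\<^sub>n\<close> do not depend on \<open>\<alpha>\<close> and whose positions are affine in \<open>\<alpha>\<close>.
  Integrating (\<open>integrals_g_tilde\<close>) gives the slope \<open>k = K / D\<close> with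
  \<open>D = \<Sum> d\<^sub>n / \<beta>\<^sup>n\<close> and \<open>K = \<Sum> s\<^sub>n d\<^sub>n / \<beta>\<^sup>n\<close>, and the intercept \<open>(1 - \<delta> k) / 2\<close>.
  Summing the geometric series (\<open>D_K_closed\<close>) turns \<open>k\<close> into
  \<open>slope q m \<epsilon>\<close>, a rational function of \<open>q\<close>, \<open>m\<close> and \<open>\<epsilon>\<close>.

  Two inequalities between consecutive \<open>m\<close> remain, one for \<open>k\<close> and one, in the opposite
  direction, for \<open>\<epsilon> k\<close>, since the intercept is \<open>(1 - q \<epsilon> k) / 2\<close>. Both rest on the exponential
  smallness of \<open>\<epsilon>\<close>. Dropping the \<open>\<epsilon>\<close> that belongs to \<open>m + 1\<close> makes the slope for \<open>m + 1\<close>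
  smaller, and yet it still exceeds the slope for \<open>m\<close> (\<open>slope_less_slope_0\<close>, \<open>eps_small\<close>).
  On the other side \<open>\<epsilon>\<close> shrinks by more than the factor \<open>\<beta>\<close> when \<open>m\<close> grows by one
  (\<open>eps_Suc_less\<close>), which beats the linear growth of the numerator of the slope
  (\<open>eps_slope_decreasing_criterion\<close>). For a few pairs with
  \<open>q \<le> 2\<close> and \<open>m \<le> 3\<close> these estimates are too crude, and decimal enclosures of \<open>\<epsilon>\<close>
  decide (\<open>eps_numeric\<close>).
\<close>

section \<open>The root of the defining equation\<close>

definition multinacci_root :: "nat \<Rightarrow> nat \<Rightarrow> real \<Rightarrow> bool" where
  "multinacci_root q m x \<longleftrightarrow> real q < x \<and> x < real q + 1 \<and> x ^ m = (\<Sum>i<m. real q * x ^ i)"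

text \<open>The ratio \<open>(\<Sum>i<m. c * x ^ i) / x ^ m\<close> is strictly decreasing on the positive reals. This gives
  uniqueness of the root and decides on which side of the root a given number lies.\<close>

lemma power_sum_cross:
  fixes x y c :: real
  assumes "0 < x" "x < y" "0 < c" "0 < m" "y ^ m \<le> (\<Sum>i<m. c * y ^ i)"
  shows "x ^ m < (\<Sum>i<m. c * x ^ i)"
proof -
  have cross: "x ^ m * y ^ i < y ^ m * x ^ i" if "i < m" for i
  proof -
    have "x ^ (m - i) < y ^ (m - i)" using assms that by (intro power_strict_mono) auto
    then have "(x ^ i * y ^ i) * x ^ (m - i) < (x ^ i * y ^ i) * y ^ (m - i)"
      using assms by (intro mult_strict_left_mono) auto
    moreover have "x ^ m = x ^ i * x ^ (m - i)" "y ^ m = y ^ i * y ^ (m - i)"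
      using that by (simp_all flip: power_add)
    ultimately show ?thesis by (simp add: mult_ac)
  qed
  have "y ^ m * x ^ m \<le> x ^ m * (\<Sum>i<m. c * y ^ i)"
    using assms by (simp add: mult.commute)
  also have "\<dots> = (\<Sum>i<m. c * (x ^ m * y ^ i))"
    by (simp add: sum_distrib_left mult_ac)
  also have "\<dots> < (\<Sum>i<m. c * (y ^ m * x ^ i))"
    using assms cross by (intro sum_strict_mono mult_strict_left_mono) (auto simp: lessThan_empty_iff)
  also have "\<dots> = y ^ m * (\<Sum>i<m. c * x ^ i)"
    by (simp add: sum_distrib_left mult_ac)
  finally show ?thesis using assms by (auto simp: mult_less_cancel_left_pos)
qed

lemma multinacci_root_lower:
  assumes "multinacci_root q m b" "q \<ge> 1" "m \<ge> 2" "0 < x" "x ^ m < (\<Sum>i<m. real q * x ^ i)"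
  shows "x < b"
proof (rule ccontr)
  assume "\<not> x < b"
  then consider "x = b" | "b < x" by linarith
  then show False
  proof cases
    case 2
    have "b ^ m < (\<Sum>i<m. real q * b ^ i)"
      using assms 2 by (intro power_sum_cross[of b x]) (auto simp: multinacci_root_def)
    then show False using assms by (auto simp: multinacci_root_def)
  qed (use assms in \<open>auto simp: multinacci_root_def\<close>)
qed

lemma multinacci_root_upper:
  assumes "multinacci_root q m b" "q \<ge> 1" "m \<ge> 2" "x ^ m > (\<Sum>i<m. real q * x ^ i)"
  shows "b < x \<or> x \<le> 0"
  using assms power_sum_cross[of x b "real q" m]
  by (cases "x = b") (force simp: multinacci_root_def)+

lemma multinacci_root_unique:
  assumes "multinacci_root q m a" "multinacci_root q m b" "q \<ge> 1" "m \<ge> 2"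
  shows "a = b"
  using power_sum_cross[of a b "real q" m] power_sum_cross[of b a "real q" m] assms
  by (cases a b rule: linorder_cases) (auto simp: multinacci_root_def)

lemma multinacci_root_exists:
  assumes "q \<ge> 1" "m \<ge> 2"
  shows "\<exists>x. multinacci_root q m x"
proof -
  define f :: "real \<Rightarrow> real" where "f x = x ^ m - (\<Sum>i<m. real q * x ^ i)" for x
  obtain l where l: "m = Suc (Suc l)" using assms(2) by (metis add_2_eq_Suc le_Suc_ex)
  have lo: "f (real q) < 0"
  proof -
    have "0 \<le> (\<Sum>i<l. real q * real q ^ i)" by (intro sum_nonneg) auto
    moreover have "0 < real q * real q ^ l" using assms by simp
    ultimately show ?thesis by (simp add: f_def l)
  qed
  have hi: "f (real q + 1) = 1"
    using power_diff_1_eq[of "real q + 1" m] by (simp add: f_def sum_distrib_left)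
  have "\<exists>x\<ge>real q. x \<le> real q + 1 \<and> f x = 0"
    using lo hi by (intro IVT') (auto simp: f_def intro!: continuous_intros)
  then obtain x where x: "real q \<le> x" "x \<le> real q + 1" "f x = 0" by blast
  with lo hi have "x \<noteq> real q" "x \<noteq> real q + 1" by auto
  with x show ?thesis by (auto simp: multinacci_root_def f_def intro!: exI[of _ x])
qed

lemma multinacci_root_beta_qm:
  assumes "q \<ge> 1" "m \<ge> 2"
  shows "multinacci_root q m (beta_qm q m)"
proof -
  have "\<exists>!x. multinacci_root q m x" using multinacci_root_exists multinacci_root_unique assms by metis
  from theI'[OF this] show ?thesis unfolding beta_qm_def multinacci_root_def .
qed

text \<open>Multiplying the equation for \<open>m\<close> by \<open>\<beta>\<close> yields the equation for \<open>m + 1\<close> without its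
  constant term \<open>q\<close>.\<close>

lemma beta_qm_less_Suc:
  assumes "q \<ge> 1" "m \<ge> 2"
  shows "beta_qm q m < beta_qm q (Suc m)"
proof (rule multinacci_root_lower[OF multinacci_root_beta_qm])
  let ?b = "beta_qm q m"
  have b: "multinacci_root q m ?b" by (rule multinacci_root_beta_qm[OF assms])
  have "?b ^ Suc m = ?b * (\<Sum>i<m. real q * ?b ^ i)" using b by (simp add: multinacci_root_def)
  also have "\<dots> = (\<Sum>i<m. real q * ?b ^ Suc i)" by (simp add: sum_distrib_left mult_ac)
  also have "\<dots> < (\<Sum>i<Suc m. real q * ?b ^ i)"
    using assms by (subst sum.lessThan_Suc_shift) auto
  finally show "?b ^ Suc m < (\<Sum>i<Suc m. real q * ?b ^ i)" .
  show "0 < ?b" using b by (auto simp: multinacci_root_def)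
qed (use assms in auto)

section \<open>The orbits of 0 and 1\<close>

locale multinacci =
  fixes q m :: nat and \<beta> :: real
  assumes q: "q \<ge> 1" and m: "m \<ge> 2" and root: "multinacci_root q m \<beta>"
begin

lemma \<beta>_bounds: "real q < \<beta>" "\<beta> < real q + 1" "1 < \<beta>" "0 < \<beta>"
  using root q by (auto simp: multinacci_root_def)

definition \<delta> :: real where "\<delta> = real q + 1 - \<beta>"

definition s :: "nat \<Rightarrow> real" where "s n = (\<Sum>i<n. \<beta> ^ i)"

text \<open>The distance between the \<open>n\<close>-th iterates of 1 and of 0, provided that at every step before the
  \<open>n\<close>-th the integer parts removed differ by exactly \<open>q\<close>.\<close>

definition d :: "nat \<Rightarrow> real" where "d n = 1 - \<delta> * s n"

lemma \<delta>_bounds: "0 < \<delta>" "\<delta> < 1" using \<beta>_bounds by (auto simp: \<delta>_def)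

lemma s_simps: "s 0 = 0" "s (Suc n) = \<beta> * s n + 1" "s (Suc 0) = 1"
proof -
  show "s (Suc n) = \<beta> * s n + 1"
    unfolding s_def by (subst sum.lessThan_Suc_shift) (simp add: sum_distrib_left)
qed (simp_all add: s_def)

lemma s_mono: "i \<le> n \<Longrightarrow> s i \<le> s n"
  unfolding s_def using \<beta>_bounds by (intro sum_mono2) auto

lemma s_nonneg: "0 \<le> s n"
  using s_mono[of 0 n] by (simp add: s_simps)

lemma s_closed: "(\<beta> - 1) * s n = \<beta> ^ n - 1"
  unfolding s_def by (simp add: power_diff_1_eq)

lemma s_m: "\<delta> * s m = 1"
proof -
  have "real q * s m = \<beta> ^ m" using root by (simp add: multinacci_root_def s_def sum_distrib_left)
  with s_closed[of m] show ?thesis by (simp add: \<delta>_def algebra_simps)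
qed

lemma d_simps: "d 0 = 1" "d m = 0" "\<beta> * d n = real q + d (Suc n)"
  using s_m by (simp_all add: d_def s_simps \<delta>_def algebra_simps)

lemma d_nonneg: "n \<le> m \<Longrightarrow> 0 \<le> d n"
  using mult_left_mono[OF s_mono[of n m], of \<delta>] s_m \<delta>_bounds by (simp add: d_def)

text \<open>The point is that the orbit of 1 stays below 1 without crossing another integer:
  \<open>\<alpha> s\<^sub>n + d\<^sub>n = 1 - (\<delta> - \<alpha>) s\<^sub>n < 1\<close> for \<open>n \<ge> 1\<close>, exactly because \<open>\<alpha> < \<delta>\<close>. Hence the integer
  parts removed are 0 along one orbit and \<open>q\<close> along the other.\<close>

lemma orbits:
  assumes \<alpha>: "0 \<le> \<alpha>" "\<alpha> < \<delta>" and "n \<le> m"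
  shows "(T \<beta> \<alpha> ^^ n) 0 = \<alpha> * s n" "(T \<beta> \<alpha> ^^ n) 1 = \<alpha> * s n + d n"
proof -
  have "(T \<beta> \<alpha> ^^ n) 0 = \<alpha> * s n \<and> (T \<beta> \<alpha> ^^ n) 1 = \<alpha> * s n + d n"
    using \<open>n \<le> m\<close>
  proof (induction n)
    case 0
    show ?case by (simp add: s_simps d_simps)
  next
    case (Suc n)
    have "0 < s (Suc n)"
      using s_mono[of "Suc 0" "Suc n"] by (simp add: s_simps)
    then have "\<alpha> * s (Suc n) < \<delta> * s (Suc n)"
      using \<alpha> by (intro mult_strict_right_mono)
    then have lt: "\<alpha> * s (Suc n) + d (Suc n) < 1" by (simp add: d_def)
    have nn: "0 \<le> \<alpha> * s (Suc n)" "0 \<le> d (Suc n)"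
      using \<alpha> s_nonneg d_nonneg[OF Suc.prems] by auto
    have e0: "\<beta> * (\<alpha> * s n) + \<alpha> = \<alpha> * s (Suc n)"
      by (simp add: s_simps algebra_simps)
    have e1: "\<beta> * (\<alpha> * s n + d n) + \<alpha> = real q + (\<alpha> * s (Suc n) + d (Suc n))"
      using d_simps(3)[of n] by (simp add: s_simps algebra_simps)
    have f0: "\<lfloor>\<alpha> * s (Suc n)\<rfloor> = 0" using lt nn by (simp add: floor_eq_iff)
    have f1: "\<lfloor>real q + (\<alpha> * s (Suc n) + d (Suc n))\<rfloor> = int q"
      using lt nn by (simp add: floor_eq_iff)
    have "n \<le> m" using Suc.prems by simp
    with Suc.IH have IH: "(T \<beta> \<alpha> ^^ n) 0 = \<alpha> * s n" "(T \<beta> \<alpha> ^^ n) 1 = \<alpha> * s n + d n" by auto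
    have "(T \<beta> \<alpha> ^^ Suc n) 0 = \<alpha> * s (Suc n)"
      using f0 by (simp add: IH T_def e0)
    moreover have "(T \<beta> \<alpha> ^^ Suc n) 1 = \<alpha> * s (Suc n) + d (Suc n)"
      unfolding funpow.simps o_apply IH T_def e1 f1 by simp
    ultimately show ?case by blast
  qed
  then show "(T \<beta> \<alpha> ^^ n) 0 = \<alpha> * s n" "(T \<beta> \<alpha> ^^ n) 1 = \<alpha> * s n + d n" by auto
qed

lemma orbits_merge:
  assumes \<alpha>: "0 \<le> \<alpha>" "\<alpha> < \<delta>" and "m \<le> n"
  shows "(T \<beta> \<alpha> ^^ n) 1 = (T \<beta> \<alpha> ^^ n) 0"
proof -
  obtain l where l: "n = l + m" using assms(3) by (metis add.commute le_Suc_ex)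
  show ?thesis unfolding l funpow_add o_apply
    using orbits[OF \<alpha> order_refl] by (simp add: d_simps)
qed

lemma orbits_range:
  assumes \<alpha>: "0 \<le> \<alpha>" "\<alpha> < \<delta>" and "n \<le> m"
  shows "0 \<le> \<alpha> * s n" "\<alpha> * s n + d n \<le> 1"
  using \<alpha> s_nonneg[of n] mult_right_mono[of \<alpha> \<delta> "s n"] by (auto simp: d_def)

section \<open>Integrating the density\<close>

text \<open>Each series converges because \<open>\<beta> > 1\<close>, and their difference is a finite sum because the orbits
  coincide from time \<open>m\<close> on.\<close>

lemma g_tilde_eq:
  assumes \<alpha>: "0 \<le> \<alpha>" "\<alpha> < \<delta>"
  shows "g_tilde \<beta> \<alpha> x = (\<Sum>n<m. 1 / \<beta> ^ n * indicat_real {\<alpha> * s n..<\<alpha> * s n + d n} x)"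
proof -
  define c where "c y n = (if x < (T \<beta> \<alpha> ^^ n) y then 1 / \<beta> ^ n else 0)" for y n
  have summ: "summable (c y)" for y
  proof (rule summable_comparison_test')
    show "summable (\<lambda>n. (1 / \<beta>) ^ n)" using \<beta>_bounds by (intro summable_geometric) auto
    show "norm (c y n) \<le> (1 / \<beta>) ^ n" if "0 \<le> n" for n
      using \<beta>_bounds by (auto simp: c_def power_divide)
  qed
  have "g_tilde \<beta> \<alpha> x = suminf (c 1) - suminf (c 0)"
    unfolding g_tilde_def c_def ..
  also have "\<dots> = (\<Sum>n. c 1 n - c 0 n)"
    by (rule suminf_diff[OF summ summ])
  also have "\<dots> = (\<Sum>n<m. c 1 n - c 0 n)"
    using orbits_merge[OF \<alpha>] by (intro suminf_finite) (auto simp: c_def)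
  also have "\<dots> = (\<Sum>n<m. 1 / \<beta> ^ n * indicat_real {\<alpha> * s n..<\<alpha> * s n + d n} x)"
  proof (rule sum.cong[OF refl])
    fix n assume "n \<in> {..<m}"
    then have n: "n \<le> m" by simp
    show "c 1 n - c 0 n = 1 / \<beta> ^ n * indicat_real {\<alpha> * s n..<\<alpha> * s n + d n} x"
      using d_nonneg[OF n] by (auto simp: c_def orbits[OF \<alpha> n] indicator_def)
  qed
  finally show ?thesis .
qed

end

lemma interval_integrals:
  fixes l r :: real
  assumes "0 \<le> l" "l \<le> r" "r \<le> 1"
  shows "set_integrable lebesgue {0..1} (indicat_real {l..<r})"
    and "(LINT x:{0..1}|lebesgue. indicat_real {l..<r} x) = r - l"
    and "set_integrable lebesgue {0..1} (\<lambda>x. x * indicat_real {l..<r} x)"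
    and "(LINT x:{0..1}|lebesgue. x * indicat_real {l..<r} x) = (r\<^sup>2 - l\<^sup>2) / 2"
proof -
  have sub: "{l..<r} \<subseteq> {0..1}" using assms by auto
  have e1: "(\<lambda>x. indicat_real {0..1} x *\<^sub>R indicat_real {l..<r} x) = indicat_real {l..<r}"
    using sub by (auto simp: indicator_def fun_eq_iff)
  have e2: "(\<lambda>x. indicat_real {0..1} x *\<^sub>R (x * indicat_real {l..<r} x)) 
      = (\<lambda>x. indicat_real {l..<r} x *\<^sub>R x)"
    using sub by (auto simp: indicator_def fun_eq_iff)
  have fin: "{l..<r} \<in> lmeasurable" by (intro bounded_set_imp_lmeasurable) auto
  show "set_integrable lebesgue {0..1} (indicat_real {l..<r})"
    unfolding set_integrable_def e1 using fin by (intro integrable_real_indicator) (auto simp: fmeasurable_def)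
  show "(LINT x:{0..1}|lebesgue. indicat_real {l..<r} x) = r - l"
    unfolding set_lebesgue_integral_def e1 using assms by simp
  have ad: "(\<lambda>x. x) absolutely_integrable_on {l..<r}"
  proof (rule set_integrable_subset)
    show "(\<lambda>x. x) absolutely_integrable_on {l..r}"
      by (intro absolutely_integrable_continuous_real continuous_intros)
  qed auto
  then show "set_integrable lebesgue {0..1} (\<lambda>x. x * indicat_real {l..<r} x)"
    unfolding set_integrable_def e2 .
  have "(LINT x:{0..1}|lebesgue. x * indicat_real {l..<r} x) = (LINT x:{l..<r}|lebesgue. x)"
    unfolding set_lebesgue_integral_def e2 ..
  also have "\<dots> = integral {l..<r} (\<lambda>x. x)" by (rule set_lebesgue_integral_eq_integral(2)[OF ad])
  also have "\<dots> = integral {l..r} (\<lambda>x. x)"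
    by (rule integral_subset_negligible) (auto intro: negligible_subset[of "{r}"])
  also have "\<dots> = (r\<^sup>2 - l\<^sup>2) / 2" using integral_ident[of l r] assms by simp
  finally show "(LINT x:{0..1}|lebesgue. x * indicat_real {l..<r} x) = (r\<^sup>2 - l\<^sup>2) / 2" .
qed

context multinacci
begin

definition D :: real where "D = (\<Sum>n<m. d n / \<beta> ^ n)"
definition K :: real where "K = (\<Sum>n<m. s n * d n / \<beta> ^ n)"

text \<open>The first moment of \<open>[l, l + d)\<close> is \<open>l d + d\<^sup>2 / 2\<close>; with \<open>l = \<alpha> s\<^sub>n\<close> it is affine in \<open>\<alpha>\<close>.
  The relation \<open>d\<^sub>n\<^sup>2 = d\<^sub>n - \<delta> s\<^sub>n d\<^sub>n\<close> removes the need for a third sum besides \<open>D\<close> and \<open>K\<close>.\<close>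

lemma integrals_g_tilde:
  assumes \<alpha>: "0 \<le> \<alpha>" "\<alpha> < \<delta>"
  shows "(LINT x:{0..1}|lebesgue. g_tilde \<beta> \<alpha> x) = D"
    and "(LINT x:{0..1}|lebesgue. x * g_tilde \<beta> \<alpha> x) = \<alpha> * K + (D - \<delta> * K) / 2"
proof -
  have le: "\<alpha> * s n \<le> \<alpha> * s n + d n" if "n \<le> m" for n
    using d_nonneg[OF that] by simp
  note ii = interval_integrals[OF orbits_range(1)[OF \<alpha>] le orbits_range(2)[OF \<alpha>]]
  have "(LINT x:{0..1}|lebesgue. g_tilde \<beta> \<alpha> x)
      = (LINT x|lebesgue. (\<Sum>n<m. indicat_real {0..1} x *\<^sub>R (1 / \<beta> ^ n * indicat_real {\<alpha> * s n..<\<alpha> * s n + d n} x)))"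
    unfolding set_lebesgue_integral_def g_tilde_eq[OF \<alpha>] by (simp add: sum_distrib_left)
  also have "\<dots> = (\<Sum>n<m. LINT x:{0..1}|lebesgue. 1 / \<beta> ^ n * indicat_real {\<alpha> * s n..<\<alpha> * s n + d n} x)"
    unfolding set_lebesgue_integral_def
    using ii(1) d_nonneg by (intro Bochner_Integration.integral_sum) (auto simp: set_integrable_def mult.left_commute)
  also have "\<dots> = (\<Sum>n<m. 1 / \<beta> ^ n * d n)"
    using ii(2) by (intro sum.cong) auto
  finally show "(LINT x:{0..1}|lebesgue. g_tilde \<beta> \<alpha> x) = D" by (simp add: D_def)
  have "(LINT x:{0..1}|lebesgue. x * g_tilde \<beta> \<alpha> x)
      = (LINT x|lebesgue. (\<Sum>n<m. indicat_real {0..1} x *\<^sub>R (1 / \<beta> ^ n * (x * indicat_real {\<alpha> * s n..<\<alpha> * s n + d n} x))))"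
    unfolding set_lebesgue_integral_def g_tilde_eq[OF \<alpha>] by (simp add: sum_distrib_left mult_ac)
  also have "\<dots> = (\<Sum>n<m. LINT x:{0..1}|lebesgue. 1 / \<beta> ^ n * (x * indicat_real {\<alpha> * s n..<\<alpha> * s n + d n} x))"
    unfolding set_lebesgue_integral_def
    using ii(3) d_nonneg by (intro Bochner_Integration.integral_sum) (auto simp: set_integrable_def mult_ac)
  also have "\<dots> = (\<Sum>n<m. 1 / \<beta> ^ n * (((\<alpha> * s n + d n)\<^sup>2 - (\<alpha> * s n)\<^sup>2) / 2))"
    using ii(4) by (intro sum.cong) (simp_all only: set_integral_mult_right lessThan_iff less_imp_le)
  also have "\<dots> = (\<Sum>n<m. \<alpha> * (s n * d n / \<beta> ^ n) + (d n / \<beta> ^ n - \<delta> * (s n * d n / \<beta> ^ n)) / 2)"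
  proof (rule sum.cong[OF refl])
    fix n
    have "(\<alpha> * s n + d n)\<^sup>2 - (\<alpha> * s n)\<^sup>2 = 2 * (\<alpha> * (s n * d n)) + (d n - \<delta> * (s n * d n))"
      by (simp add: d_def power2_eq_square algebra_simps)
    then show "1 / \<beta> ^ n * (((\<alpha> * s n + d n)\<^sup>2 - (\<alpha> * s n)\<^sup>2) / 2)
        = \<alpha> * (s n * d n / \<beta> ^ n) + (d n / \<beta> ^ n - \<delta> * (s n * d n / \<beta> ^ n)) / 2"
      using \<beta>_bounds by (simp add: field_simps)
  qed
  also have "\<dots> = \<alpha> * K + (D - \<delta> * K) / 2"
    by (simp add: D_def K_def sum.distrib sum_subtractf sum_distrib_left flip: sum_divide_distrib)
  finally show "(LINT x:{0..1}|lebesgue. x * g_tilde \<beta> \<alpha> x) = \<alpha> * K + (D - \<delta> * K) / 2" .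
qed

lemma D_pos: "0 < D"
proof -
  have "0 < d 0 / \<beta> ^ 0" by (simp add: d_simps)
  also have "\<dots> \<le> D" unfolding D_def
    using m \<beta>_bounds d_nonneg by (intro member_le_sum) auto
  finally show ?thesis .
qed

text \<open>The summand for \<open>n = 0\<close> vanishes; the one for \<open>n = 1\<close> is positive, and it occurs since
  \<open>m \<ge> 2\<close>.\<close>

lemma K_pos: "0 < K"
proof -
  have "0 < s (Suc 0) * d (Suc 0) / \<beta> ^ Suc 0" using \<beta>_bounds \<delta>_bounds by (simp add: d_def s_simps)
  also have "\<dots> \<le> K" unfolding K_def
    using m \<beta>_bounds d_nonneg s_nonneg
    by (intro member_le_sum[of "Suc 0" _ "\<lambda>n. s n * d n / \<beta> ^ n"]) auto
  finally show ?thesis .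
qed

lemma M_affine:
  assumes \<alpha>: "0 \<le> \<alpha>" "\<alpha> < \<delta>"
  shows "M \<beta> \<alpha> = (K / D) * \<alpha> + (1 - \<delta> * (K / D)) / 2"
proof -
  have "M \<beta> \<alpha> = (LINT x:{0..1}|lebesgue. x * g_tilde \<beta> \<alpha> x / D)"
    by (simp add: M_def g_def integrals_g_tilde[OF \<alpha>])
  also have "\<dots> = (LINT x:{0..1}|lebesgue. x * g_tilde \<beta> \<alpha> x) / D"
    by (rule set_integral_divide_zero)
  finally show ?thesis
    using D_pos by (simp add: integrals_g_tilde[OF \<alpha>] field_simps)
qed

definition \<epsilon> :: real where "\<epsilon> = 1 / \<beta> ^ m"

lemma \<epsilon>_bounds: "0 < \<epsilon>" "\<epsilon> < 1"
  using \<beta>_bounds m one_less_power[of \<beta> m] by (auto simp: \<epsilon>_def)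

lemma \<beta>_eq_\<epsilon>: "\<beta> = real q + 1 - real q * \<epsilon>" and \<delta>_eq_\<epsilon>: "\<delta> = real q * \<epsilon>"
proof -
  have "real q * s m = \<beta> ^ m" using root by (simp add: multinacci_root_def s_def sum_distrib_left)
  then have "\<delta> * \<beta> ^ m = real q" using s_m by (metis mult.left_commute mult.right_neutral)
  then show "\<delta> = real q * \<epsilon>" using \<beta>_bounds by (simp add: \<epsilon>_def field_simps)
  then show "\<beta> = real q + 1 - real q * \<epsilon>" by (simp add: \<delta>_def)
qed

text \<open>Since \<open>(\<beta> - 1) s\<^sub>n = \<beta>\<^sup>n - 1\<close>, all summands become combinations of \<open>\<beta>\<^bsup>-n\<^esup>\<close>, \<open>1\<close> and
  \<open>\<beta>\<^sup>n\<close>; the sum of the \<open>\<beta>\<^bsup>-n\<^esup>\<close> is just \<open>\<beta> / q\<close>, and the sum of the \<open>\<beta>\<^sup>n\<close> is \<open>1 / \<delta>\<close>.\<close>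

lemma D_K_closed:
  "(\<beta> - 1) * D = real q + 1 - real q * (real m + 1) * \<epsilon>"
  "(\<beta> - 1)\<^sup>2 * K = real q * (real m - 1) - 2 + real q * (real m + 1) * \<epsilon>"
proof -
  define G where "G = (\<Sum>n<m. 1 / \<beta> ^ n)"
  have "(1 / \<beta> - 1) * G = \<epsilon> - 1"
    unfolding G_def \<epsilon>_def using power_diff_1_eq[of "1 / \<beta>" m] by (simp add: power_divide)
  then have "(\<beta> - 1) * G = \<beta> * (1 - \<epsilon>)" using \<beta>_bounds by (simp add: field_simps)
  moreover have "\<beta> - 1 = real q * (1 - \<epsilon>)" using \<beta>_eq_\<epsilon> by (simp add: algebra_simps)
  ultimately have "(1 - \<epsilon>) * (real q * G - \<beta>) = 0" by (simp add: algebra_simps)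
  then have G: "real q * G = \<beta>" using \<epsilon>_bounds by auto
  have "(\<beta> - 1) * D = (\<Sum>n<m. (\<beta> - 1 + \<delta>) * (1 / \<beta> ^ n) - \<delta>)"
    unfolding D_def sum_distrib_left
  proof (rule sum.cong[OF refl])
    fix n
    have "(\<beta> - 1) * d n = (\<beta> - 1) - \<delta> * ((\<beta> - 1) * s n)" by (simp add: d_def algebra_simps)
    also have "\<dots> = (\<beta> - 1) - \<delta> * (\<beta> ^ n - 1)" by (simp only: s_closed)
    finally show "(\<beta> - 1) * (d n / \<beta> ^ n) = (\<beta> - 1 + \<delta>) * (1 / \<beta> ^ n) - \<delta>"
      using \<beta>_bounds by (simp add: field_simps)
  qed
  also have "\<dots> = (\<beta> - 1 + \<delta>) * G - real m * \<delta>"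
    by (simp add: G_def sum_subtractf sum_distrib_left)
  also have "\<beta> - 1 + \<delta> = real q" by (simp add: \<delta>_def)
  finally show "(\<beta> - 1) * D = real q + 1 - real q * (real m + 1) * \<epsilon>"
    using G \<beta>_eq_\<epsilon> \<delta>_eq_\<epsilon> by (simp add: algebra_simps)
  have "(\<beta> - 1)\<^sup>2 * K = (\<Sum>n<m. (\<beta> - 1 + 2 * \<delta>) - (\<beta> - 1 + \<delta>) * (1 / \<beta> ^ n) - \<delta> * \<beta> ^ n)"
    unfolding K_def sum_distrib_left
  proof (rule sum.cong[OF refl])
    fix n
    have "(\<beta> - 1)\<^sup>2 * (s n * d n) = ((\<beta> - 1) * s n) * ((\<beta> - 1) - \<delta> * ((\<beta> - 1) * s n))"
      by (simp add: d_def power2_eq_square algebra_simps)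
    also have "\<dots> = (\<beta> ^ n - 1) * ((\<beta> - 1) - \<delta> * (\<beta> ^ n - 1))" by (simp only: s_closed)
    finally have "(\<beta> - 1)\<^sup>2 * (s n * d n) = (\<beta> ^ n - 1) * ((\<beta> - 1) - \<delta> * (\<beta> ^ n - 1))" .
    then have "(\<beta> - 1)\<^sup>2 * (s n * d n / \<beta> ^ n) = (\<beta> ^ n - 1) * ((\<beta> - 1) - \<delta> * (\<beta> ^ n - 1)) / \<beta> ^ n"
      by simp
    also have "\<dots> = (\<beta> - 1 + 2 * \<delta>) - (\<beta> - 1 + \<delta>) * (1 / \<beta> ^ n) - \<delta> * \<beta> ^ n"
      using \<beta>_bounds by (simp add: field_simps)
    finally show "(\<beta> - 1)\<^sup>2 * (s n * d n / \<beta> ^ n)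
        = (\<beta> - 1 + 2 * \<delta>) - (\<beta> - 1 + \<delta>) * (1 / \<beta> ^ n) - \<delta> * \<beta> ^ n" .
  qed
  also have "\<dots> = real m * (\<beta> - 1 + 2 * \<delta>) - (\<beta> - 1 + \<delta>) * G - \<delta> * s m"
    by (simp add: G_def s_def sum_subtractf sum_distrib_left)
  also have "\<beta> - 1 + \<delta> = real q" by (simp add: \<delta>_def)
  also have "\<beta> - 1 + 2 * \<delta> = real q + real q * \<epsilon>"
    using \<beta>_eq_\<epsilon> \<delta>_eq_\<epsilon> by simp
  finally show "(\<beta> - 1)\<^sup>2 * K = real q * (real m - 1) - 2 + real q * (real m + 1) * \<epsilon>"
    using G s_m \<beta>_eq_\<epsilon> by (simp add: algebra_simps)
qed

end


section \<open>Closed form of the coefficients\<close>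

definition slope :: "real \<Rightarrow> real \<Rightarrow> real \<Rightarrow> real" where
  "slope q m \<epsilon> =
     (q * (m - 1) - 2 + q * (m + 1) * \<epsilon>) / (q * (1 - \<epsilon>) * (q + 1 - q * (m + 1) * \<epsilon>))"

context multinacci
begin

text \<open>Numerator and last factor of the denominator of the slope inherit their signs from \<open>K\<close>
  and \<open>D\<close>, which is easier than estimating \<open>\<epsilon>\<close>.\<close>

lemma N_U_pos:
  "0 < real q * (real m - 1) - 2 + real q * (real m + 1) * \<epsilon>"
  "real q * (real m + 1) * \<epsilon> < real q + 1"
proof -
  have "0 < (\<beta> - 1)\<^sup>2 * K" "0 < (\<beta> - 1) * D" using \<beta>_bounds K_pos D_pos by auto
  then show "0 < real q * (real m - 1) - 2 + real q * (real m + 1) * \<epsilon>"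
    "real q * (real m + 1) * \<epsilon> < real q + 1"
    unfolding D_K_closed by auto
qed

lemma K_over_D: "K / D = slope (real q) (real m) \<epsilon>"
proof -
  have p: "\<beta> - 1 = real q * (1 - \<epsilon>)" using \<beta>_eq_\<epsilon> by (simp add: algebra_simps)
  have "K / D = ((\<beta> - 1)\<^sup>2 * K) / ((\<beta> - 1) * ((\<beta> - 1) * D))"
    using \<beta>_bounds D_pos by (simp add: power2_eq_square)
  also have "\<dots> = slope (real q) (real m) \<epsilon>"
    unfolding D_K_closed by (simp add: p slope_def)
  finally show ?thesis .
qed

lemma frac_\<beta>: "1 - frac \<beta> = \<delta>"
proof -
  have "\<lfloor>\<beta>\<rfloor> = int q" using \<beta>_bounds by (simp add: floor_eq_iff)
  then show ?thesis by (simp add: frac_def \<delta>_def)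
qed

text \<open>An affine function is determined by its values at 0 and \<open>\<delta> / 2\<close>, so the pair is unique.\<close>

lemma affine_coeffs_eq:
  "(THE (k, c). \<forall>\<alpha>\<in>{0..<1 - frac \<beta>}. M \<beta> \<alpha> = k * \<alpha> + c) = (K / D, (1 - \<delta> * (K / D)) / 2)"
proof (rule the_equality)
  show "case (K / D, (1 - \<delta> * (K / D)) / 2) of
      (k, c) \<Rightarrow> \<forall>\<alpha>\<in>{0..<1 - frac \<beta>}. M \<beta> \<alpha> = k * \<alpha> + c"
    using M_affine by (simp add: frac_\<beta>)
next
  fix kc :: "real \<times> real"
  assume "case kc of (k, c) \<Rightarrow> \<forall>\<alpha>\<in>{0..<1 - frac \<beta>}. M \<beta> \<alpha> = k * \<alpha> + c"
  then obtain k c where kc: "kc = (k, c)"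
    and "\<And>\<alpha>. 0 \<le> \<alpha> \<Longrightarrow> \<alpha> < \<delta> \<Longrightarrow> M \<beta> \<alpha> = k * \<alpha> + c"
    by (cases kc) (auto simp: frac_\<beta>)
  then have eq: "k * \<alpha> + c = (K / D) * \<alpha> + (1 - \<delta> * (K / D)) / 2" if "0 \<le> \<alpha>" "\<alpha> < \<delta>" for \<alpha>
    using M_affine[OF that] that by simp
  have c: "c = (1 - \<delta> * (K / D)) / 2" using eq[of 0] \<delta>_bounds by simp
  have "k * (\<delta> / 2) = (K / D) * (\<delta> / 2)" using eq[of "\<delta> / 2"] \<delta>_bounds c by simp
  moreover have "\<delta> / 2 \<noteq> 0" using \<delta>_bounds by simp
  ultimately have "k = K / D" by (metis mult_right_cancel)
  with c kc show "kc = (K / D, (1 - \<delta> * (K / D)) / 2)" by simp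
qed

end

definition eps :: "nat \<Rightarrow> nat \<Rightarrow> real" where "eps q m = 1 / beta_qm q m ^ m"

lemma multinacci_beta_qm: "q \<ge> 1 \<Longrightarrow> m \<ge> 2 \<Longrightarrow> multinacci q m (beta_qm q m)"
  by unfold_locales (auto intro: multinacci_root_beta_qm)

lemma eps_facts:
  assumes "q \<ge> 1" "m \<ge> 2"
  shows "0 < eps q m" "eps q m < 1" "beta_qm q m = real q + 1 - real q * eps q m"
    "real q * (real m + 1) * eps q m < real q + 1"
    "0 < real q * (real m - 1) - 2 + real q * (real m + 1) * eps q m"
proof -
  interpret multinacci q m "beta_qm q m" by (rule multinacci_beta_qm[OF assms])
  have e: "eps q m = \<epsilon>" by (simp add: eps_def \<epsilon>_def)
  show "0 < eps q m" "eps q m < 1" "beta_qm q m = real q + 1 - real q * eps q m"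
    "real q * (real m + 1) * eps q m < real q + 1"
    "0 < real q * (real m - 1) - 2 + real q * (real m + 1) * eps q m"
    unfolding e using \<epsilon>_bounds \<beta>_eq_\<epsilon> N_U_pos by auto
qed

lemma k_b_qm_eq:
  assumes "q \<ge> 1" "m \<ge> 2"
  shows "k_qm q m = slope q m (eps q m)"
    and "b_qm q m = (1 - real q * (eps q m * slope q m (eps q m))) / 2"
proof -
  interpret multinacci q m "beta_qm q m" by (rule multinacci_beta_qm[OF assms])
  have e: "eps q m = \<epsilon>" by (simp add: eps_def \<epsilon>_def)
  have "affine_coeffs q m = (K / D, (1 - \<delta> * (K / D)) / 2)"
    unfolding affine_coeffs_def by (rule affine_coeffs_eq)
  then show "k_qm q m = slope q m (eps q m)"
    and "b_qm q m = (1 - real q * (eps q m * slope q m (eps q m))) / 2"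
    by (simp_all add: k_qm_def b_qm_def K_over_D \<delta>_eq_\<epsilon> e mult.assoc)
qed

section \<open>Locating the root\<close>

text \<open>Summing the geometric series turns the position of \<open>x\<close> relative to the root into a comparison
  of \<open>x ^ m * (q + 1 - x)\<close> with \<open>q\<close>, which is convenient for numerical bounds.\<close>

lemma geometric_scaled:
  fixes x :: real
  assumes "1 < x"
  shows "x ^ m - (\<Sum>i<m. q * x ^ i) = (q - x ^ m * (q + 1 - x)) / (x - 1)"
proof -
  have "(x - 1) * (\<Sum>i<m. q * x ^ i) = q * (x ^ m - 1)"
    by (simp add: power_diff_1_eq sum_distrib_left mult_ac)
  then show ?thesis using assms by (simp add: field_simps)
qed

lemma less_beta_qm:
  assumes "q \<ge> 1" "m \<ge> 2" "1 < x" "real q < x ^ m * (real q + 1 - x)"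
  shows "x < beta_qm q m"
proof (rule multinacci_root_lower[OF multinacci_root_beta_qm])
  have "x ^ m - (\<Sum>i<m. real q * x ^ i) < 0"
    unfolding geometric_scaled[OF \<open>1 < x\<close>] using assms by (intro divide_neg_pos) auto
  then show "x ^ m < (\<Sum>i<m. real q * x ^ i)" by simp
qed (use assms in auto)

lemma beta_qm_less:
  assumes "q \<ge> 1" "m \<ge> 2" "1 < x" "x ^ m * (real q + 1 - x) < real q"
  shows "beta_qm q m < x"
proof -
  have "0 < x ^ m - (\<Sum>i<m. real q * x ^ i)"
    unfolding geometric_scaled[OF \<open>1 < x\<close>] using assms by (intro divide_pos_pos) auto
  then show ?thesis
    using multinacci_root_upper[OF multinacci_root_beta_qm[OF assms(1,2)] assms(1,2), of x] assms by auto
qed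

text \<open>The substitution \<open>x = q + 1 - q c\<close> in \<open>less_beta_qm\<close> and \<open>beta_qm_less\<close>.\<close>

lemma eps_bracket:
  assumes "q \<ge> 1" "m \<ge> 2"
  shows "0 < c \<Longrightarrow> c < 1 \<Longrightarrow> (real q + 1 - real q * c) ^ m * c < 1 \<Longrightarrow> c < eps q m"
    and "0 < c \<Longrightarrow> c < 1 \<Longrightarrow> 1 < (real q + 1 - real q * c) ^ m * c \<Longrightarrow> eps q m < c"
proof -
  let ?x = "real q + 1 - real q * c"
  have x: "?x ^ m * (real q + 1 - ?x) = real q * (?x ^ m * c)" by simp
  have gt1: "1 < ?x" if "c < 1"
  proof -
    have "real q * c < real q * 1" using that assms by (intro mult_strict_left_mono) auto
    then show ?thesis by simp
  qed
  show "c < eps q m" if c: "0 < c" "c < 1" "?x ^ m * c < 1"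
  proof -
    have "beta_qm q m < ?x"
      using gt1 c assms by (intro beta_qm_less) (simp_all only: x, simp_all)
    then show ?thesis using eps_facts(3)[OF assms] assms by simp
  qed
  show "eps q m < c" if c: "0 < c" "c < 1" "1 < ?x ^ m * c"
  proof -
    have "?x < beta_qm q m"
      using gt1 c assms by (intro less_beta_qm) (simp_all only: x, simp_all)
    then show ?thesis using eps_facts(3)[OF assms] assms by simp
  qed
qed

text \<open>The true values are about 0.3820, 0.1607, 0.0724 for \<open>q = 1\<close> and 0.1340, 0.0402 for \<open>q = 2\<close>.\<close>

lemma eps_numeric:
  "eps 1 2 \<in> {38/100<..<39/100}" "eps 1 3 \<in> {16/100<..<162/1000}" "eps 1 4 \<in> {1/16<..<725/10000}"
  "13/100 < eps 2 2" "eps 2 3 < 41/1000"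
  using eps_bracket(1)[of 1 2 "38/100"] eps_bracket(2)[of 1 2 "39/100"]
    eps_bracket(1)[of 1 3 "16/100"] eps_bracket(2)[of 1 3 "162/1000"]
    eps_bracket(1)[of 1 4 "1/16"] eps_bracket(2)[of 1 4 "725/10000"]
    eps_bracket(1)[of 2 2 "13/100"] eps_bracket(2)[of 2 3 "41/1000"]
  by (simp_all add: power_divide)

section \<open>The slopes increase\<close>

lemma slope_mono:
  assumes "0 < q" "0 \<le> m" "0 \<le> e" "e \<le> e'" "e' < 1" "q * (m + 1) * e' < q + 1"
    and "0 \<le> q * (m - 1) - 2 + q * (m + 1) * e"
  shows "slope q m e \<le> slope q m e'" "e * slope q m e \<le> e' * slope q m e'"
proof -
  have u: "q * (m + 1) * e \<le> q * (m + 1) * e'" using assms by (intro mult_left_mono) auto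
  show le: "slope q m e \<le> slope q m e'"
    unfolding slope_def
  proof (rule frac_le)
    show "0 \<le> q * (m - 1) - 2 + q * (m + 1) * e'" using assms(7) u by linarith
    show "q * (1 - e') * (q + 1 - q * (m + 1) * e') \<le> q * (1 - e) * (q + 1 - q * (m + 1) * e)"
      using assms(1-6) u by (intro mult_mono; (linarith | simp))
    show "0 < q * (1 - e') * (q + 1 - q * (m + 1) * e')" using assms by simp
  qed (rule u[THEN add_left_mono])
  have "0 \<le> q + 1 - q * (m + 1) * e" using assms(6) u by linarith
  then have "0 \<le> slope q m e"
    unfolding slope_def using assms by (intro divide_nonneg_nonneg mult_nonneg_nonneg) auto
  with le show "e * slope q m e \<le> e' * slope q m e'"
    using assms by (intro mult_mono) auto
qed

text \<open>With \<open>u = q (m + 1) e\<close>, clearing denominators in the conclusion leaves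
  \<open>(q + 1) q > (q + 1) u + (q m - 2) (u + (q + 1) e)\<close> up to the nonnegative term
  \<open>(q m - 2) e u\<close>. The right-hand side is a multiple of
  \<open>e\<close>, and the inequality is the smallness hypothesis.\<close>

lemma slope_less_slope_0:
  assumes q: "1 \<le> q" and m: "2 \<le> q * m" "0 < m" and e: "0 < e" "e < 1" "q * (m + 1) * e < q + 1"
    and small: "e * ((q + 1) * q * (m + 1) + (q * m - 2) * q * (m + 1) + (q * m - 2) * (q + 1))
      < q * (q + 1)"
  shows "slope q m e < slope q (m + 1) 0"
proof -
  define u where "u = q * (m + 1) * e"
  \<comment> \<open>The only quadratic term in \<open>e\<close>; it has the favourable sign.\<close>
  have "0 \<le> (q * m - 2) * (e * u)" using assms by (auto simp: u_def)
  then have "(q + 1) * (q * (m - 1) - 2 + u) < (q * m - 2) * ((1 - e) * (q + 1 - u))"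
    using small by (simp add: u_def algebra_simps)
  moreover have "0 < (1 - e) * (q + 1 - u)" using e by (simp add: u_def)
  ultimately have "(q * (m - 1) - 2 + u) / ((1 - e) * (q + 1 - u)) < (q * m - 2) / (q + 1)"
    using q by (simp add: divide_simps mult.commute)
  then have "(q * (m - 1) - 2 + u) / ((1 - e) * (q + 1 - u)) / q < (q * m - 2) / (q + 1) / q"
    using q by (intro divide_strict_right_mono) auto
  then show ?thesis by (simp add: slope_def u_def mult_ac)
qed

text \<open>The two leading terms of \<open>\<Sum>i<m. q * \<beta> ^ i\<close>, with \<open>\<beta>\<close> replaced by the smaller \<open>q\<close>.\<close>

lemma beta_qm_power_gt:
  assumes "q \<ge> 1" "m \<ge> 2"
  shows "(real q + 1) * real q ^ (m - 1) < beta_qm q m ^ m"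
proof -
  obtain l where l: "m = Suc (Suc l)" using assms(2) by (metis add_2_eq_Suc le_Suc_ex)
  let ?b = "beta_qm q m"
  have b: "real q < ?b" "?b ^ m = (\<Sum>i<m. real q * ?b ^ i)"
    using multinacci_root_beta_qm[OF assms] by (auto simp: multinacci_root_def)
  have "real q ^ Suc l < ?b ^ Suc l" "real q ^ l \<le> ?b ^ l"
    using b(1) by (intro power_strict_mono power_mono; simp)+
  then have "real q * real q ^ Suc l < real q * ?b ^ Suc l" "real q * real q ^ l \<le> real q * ?b ^ l"
    using assms by (intro mult_strict_left_mono mult_left_mono; simp)+
  moreover have "0 \<le> (\<Sum>i<l. real q * ?b ^ i)" using b by (intro sum_nonneg) auto
  moreover have "?b ^ m = (\<Sum>i<l. real q * ?b ^ i) + real q * ?b ^ l + real q * ?b ^ Suc l"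
    unfolding b(2) by (simp add: l)
  moreover have "(real q + 1) * real q ^ (m - 1) = real q * real q ^ Suc l + real q * real q ^ l"
    by (simp add: l algebra_simps)
  ultimately show ?thesis by linarith
qed

lemma eps_times_less_1:
  assumes "q \<ge> 1" "m \<ge> 2" "c < beta_qm q m ^ m"
  shows "eps q m * c < 1"
proof -
  have "0 < beta_qm q m" using multinacci_root_beta_qm[OF assms(1,2)] by (simp add: multinacci_root_def)
  then have "0 < beta_qm q m ^ m" by simp
  with assms(3) show ?thesis by (simp add: eps_def)
qed

text \<open>This and the next two bounds compare exponentials with the quadratic polynomials in \<open>m\<close> to
  which the smallness condition of \<open>slope_less_slope_0\<close> reduces for \<open>q = 1\<close>, \<open>q = 2\<close> and
  \<open>q \<ge> 3\<close>. In the third case the polynomial is a cruder one that is independent of \<open>q\<close>.\<close>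

lemma power_19_10_ge: "m \<ge> 4 \<Longrightarrow> real m - 2 + real m * (real m + 1) / 2 \<le> (19 / 10) ^ m"
proof (induction m rule: dec_induct)
  case base
  show ?case by (simp add: power_divide)
next
  case (step n)
  have n: "4 \<le> real n" using step by simp
  have "4 * 4 \<le> real n * real n" using n by (intro mult_mono) auto
  then have "real (Suc n) - 2 + real (Suc n) * (real (Suc n) + 1) / 2
      \<le> 19 / 10 * (real n - 2 + real n * (real n + 1) / 2)"
    using n by (simp add: field_simps)
  also have "\<dots> \<le> 19 / 10 * (19 / 10) ^ n" using step.IH by simp
  finally show ?case by simp
qed

lemma power_two_ge: "m \<ge> 2 \<Longrightarrow> 2 * (real m)\<^sup>2 + 6 * real m - 2 \<le> 9 * 2 ^ (m - 1)"
proof (induction m rule: dec_induct)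
  case (step n)
  have n: "2 \<le> real n" using step by simp
  have "2 * 2 \<le> real n * real n" using n by (intro mult_mono) auto
  then have "2 * (real (Suc n))\<^sup>2 + 6 * real (Suc n) - 2 \<le> 2 * (2 * (real n)\<^sup>2 + 6 * real n - 2)"
    using n by (simp add: power2_eq_square algebra_simps)
  also have "\<dots> \<le> 2 * (9 * 2 ^ (n - 1))" using step.IH by simp
  also have "\<dots> = 9 * 2 ^ (Suc n - 1)" using step by (cases n) auto
  finally show ?case .
qed simp

lemma power_three_ge: "m \<ge> 2 \<Longrightarrow> (real m + 1)\<^sup>2 + real m \<le> 4 * 3 ^ (m - 1)"
proof (induction m rule: dec_induct)
  case (step n)
  have n: "2 \<le> real n" using step by simp
  have "2 * 2 \<le> real n * real n" using n by (intro mult_mono) auto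
  then have "(real (Suc n) + 1)\<^sup>2 + real (Suc n) \<le> 3 * ((real n + 1)\<^sup>2 + real n)"
    using n by (simp add: power2_eq_square algebra_simps)
  also have "\<dots> \<le> 3 * (4 * 3 ^ (n - 1))" using step.IH by simp
  also have "\<dots> = 4 * 3 ^ (Suc n - 1)" using step by (cases n) auto
  finally show ?case .
qed simp

text \<open>For \<open>q = 1\<close> and \<open>m \<le> 3\<close> the condition is false. The case \<open>q = 2\<close> is separate because
  at \<open>m = 2\<close> the bound \<open>\<beta>\<^sup>m > (q + 1) q\<^bsup>m-1\<^esup>\<close> is only just good enough and leaves no room for a
  cruder polynomial; \<open>q = 1\<close> needs a bound on \<open>\<beta>\<close> itself, as powers of \<open>q\<close> do not grow.\<close>

lemma eps_small:
  assumes q: "q \<ge> 1" and m: "m \<ge> 2" and large: "q \<ge> 2 \<or> m \<ge> 4"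
  shows "eps q m * ((real q + 1) * q * (real m + 1) + (real q * m - 2) * q * (real m + 1)
      + (real q * m - 2) * (real q + 1)) < real q * (real q + 1)"
proof -
  consider "q = 1" | "q = 2" | "q \<ge> 3" using q by linarith
  then show ?thesis
  proof cases
    case 1
    with large have m4: "m \<ge> 4" by simp
    have "(19 / 10 :: real) ^ 4 \<le> (19 / 10) ^ m" using m4 by (intro power_increasing) auto
    moreover have "10 < (19 / 10 :: real) ^ 4" by (simp add: power_divide)
    ultimately have "10 < (19 / 10 :: real) ^ m" by linarith
    then have "19 / 10 < beta_qm 1 m" using m by (intro less_beta_qm) simp_all
    then have "(19 / 10) ^ m < beta_qm 1 m ^ m" using m by (intro power_strict_mono) auto
    with power_19_10_ge[OF m4] have "eps 1 m * (real m - 2 + real m * (real m + 1) / 2) < 1"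
      using m by (intro eps_times_less_1) auto
    then show ?thesis using 1 by (simp add: field_simps)
  next
    case 2
    have "(2 * (real m)\<^sup>2 + 6 * real m - 2) / 3 < beta_qm 2 m ^ m"
      using power_two_ge[OF m] beta_qm_power_gt[of 2 m] m by simp
    then have "eps 2 m * ((2 * (real m)\<^sup>2 + 6 * real m - 2) / 3) < 1"
      using m by (intro eps_times_less_1) auto
    then show ?thesis using 2 by (simp add: power2_eq_square algebra_simps)
  next
    case 3
    have e: "0 < eps q m" by (rule eps_facts(1)[OF q m])
    have "4 * 3 ^ (m - 1) \<le> (real q + 1) * real q ^ (m - 1)"
      using 3 by (intro mult_mono power_mono) auto
    with power_three_ge[OF m] beta_qm_power_gt[OF q m]
    have "(real m + 1)\<^sup>2 + real m < beta_qm q m ^ m" by simp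
    then have lt: "eps q m * ((real m + 1)\<^sup>2 + real m) < 1"
      by (rule eps_times_less_1[OF q m])
    have "(real q * m - 2) * q * (real m + 1) \<le> (real q + 1) * real m * q * (real m + 1)"
      by (intro mult_right_mono) (auto simp: algebra_simps)
    moreover have "(real q * m - 2) * (real q + 1) \<le> (real q * m) * (real q + 1)"
      by (intro mult_right_mono) auto
    ultimately have "(real q + 1) * q * (real m + 1) + (real q * m - 2) * q * (real m + 1)
      + (real q * m - 2) * (real q + 1) \<le> real q * (real q + 1) * ((real m + 1)\<^sup>2 + real m)"
      by (simp add: power2_eq_square algebra_simps)
    then have "eps q m * ((real q + 1) * q * (real m + 1) + (real q * m - 2) * q * (real m + 1)
      + (real q * m - 2) * (real q + 1)) \<le> eps q m * (real q * (real q + 1) * ((real m + 1)\<^sup>2 + real m))"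
      using e by (intro mult_left_mono) auto
    also have "\<dots> = real q * (real q + 1) * (eps q m * ((real m + 1)\<^sup>2 + real m))"
      by (simp only: mult_ac)
    also have "\<dots> < real q * (real q + 1) * 1"
      using lt q by (intro mult_strict_left_mono) auto
    finally show ?thesis by simp
  qed
qed

lemma k_qm_less_Suc:
  assumes q: "q \<ge> 1" and m: "m \<ge> 2"
  shows "k_qm q m < k_qm q (Suc m)"
proof -
  let ?e = "eps q m" and ?e' = "eps q (Suc m)"
  note f = eps_facts[OF q m]
  have m': "Suc m \<ge> 2" using m by simp
  note f' = eps_facts[OF q m']
  have "slope q m ?e < slope q (Suc m) ?e'"
  proof (cases "q \<ge> 2 \<or> m \<ge> 4")
    case True
    have "2 * 1 \<le> m * q" using m q by (intro mult_le_mono) auto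
    then have qm: "2 \<le> real q * real m"
      by (metis mult.commute mult.right_neutral of_nat_le_iff of_nat_mult of_nat_numeral)
    \<comment> \<open>The slope increases with its last argument, so 0 is a lower bound in place of the new value.\<close>
    have "slope q m ?e < slope q (real m + 1) 0"
      using q m f qm eps_small[OF q m True] by (intro slope_less_slope_0) auto
    also have "\<dots> \<le> slope q (real m + 1) ?e'"
      using q f' qm by (intro slope_mono(1)) (auto simp: add.commute)
    finally show ?thesis by (simp add: add.commute)
  next
    case False
    then consider "q = 1" "m = 2" | "q = 1" "m = 3" using q m by linarith
    \<comment> \<open>By monotonicity of the slope, an upper bound of the old value of \<open>\<epsilon>\<close> and a lower bound
      of the new one suffice.\<close>
    then show ?thesis
    proof cases
      case 1
      have "slope 1 2 (eps 1 2) \<le> slope 1 2 (39/100)"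
        using eps_numeric f 1 by (intro slope_mono(1)) auto
      also have "\<dots> < slope 1 3 (16/100)" by (simp add: slope_def)
      also have "\<dots> \<le> slope 1 3 (eps 1 3)"
        using eps_numeric f' 1 by (intro slope_mono(1)) (auto simp: eval_nat_numeral)
      finally show ?thesis using 1 by (simp add: eval_nat_numeral)
    next
      case 2
      have "slope 1 3 (eps 1 3) \<le> slope 1 3 (162/1000)"
        using eps_numeric f 2 by (intro slope_mono(1)) auto
      also have "\<dots> < slope 1 4 (1/16)" by (simp add: slope_def)
      also have "\<dots> \<le> slope 1 4 (eps 1 4)"
        using eps_numeric f' 2 by (intro slope_mono(1)) (auto simp: eval_nat_numeral)
      finally show ?thesis using 2 by (simp add: eval_nat_numeral)
    qed
  qed
  then show ?thesis by (simp only: k_b_qm_eq[OF q m] k_b_qm_eq[OF q m'])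
qed

section \<open>The intercepts increase\<close>

lemma beta_qm_gt_four_thirds:
  assumes q: "q \<ge> 1" and m: "m \<ge> 2"
  shows "4 / 3 < beta_qm q m"
proof (rule less_beta_qm[OF q m])
  have "(4 / 3 :: real) ^ 2 \<le> (4 / 3) ^ m" using m by (intro power_increasing) auto
  then have "(4 / 3) ^ 2 * (real q - 1 / 3) \<le> (4 / 3) ^ m * (real q - 1 / 3)"
    using q by (intro mult_right_mono) auto
  moreover have "real q < (4 / 3) ^ 2 * (real q - 1 / 3)"
    using q by (simp add: power_divide)
  ultimately show "real q < (4 / 3) ^ m * (real q + 1 - 4 / 3)" by simp
qed simp

lemma eps_Suc_less:
  assumes q: "q \<ge> 1" and m: "m \<ge> 2"
  shows "beta_qm q (Suc m) * eps q (Suc m) < eps q m"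
proof -
  have b: "0 < beta_qm q m" "beta_qm q m < beta_qm q (Suc m)"
    using multinacci_root_beta_qm[OF q m] beta_qm_less_Suc[OF q m] by (auto simp: multinacci_root_def)
  then have "beta_qm q m ^ m < beta_qm q (Suc m) ^ m" using m by (intro power_strict_mono) auto
  then show ?thesis using b by (simp add: eps_def divide_strict_left_mono)
qed

text \<open>Here \<open>e\<close> and \<open>e'\<close> belong to \<open>m\<close> and \<open>m + 1\<close>, and \<open>\<beta>' = q + 1 - q e'\<close> is the root for \<open>m + 1\<close>.
  The denominator of the slope grows with \<open>m\<close>, because \<open>(m + 2) e' \<le> (m + 1) e\<close>; this is where
  \<open>\<beta>' \<ge> 4 / 3\<close> is used, as \<open>(m + 2) / (m + 1) \<le> 4 / 3\<close>. So it suffices to compare \<open>e' N'\<close>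
  with \<open>e N\<close> for the numerators \<open>N\<close>, \<open>N'\<close>. As \<open>\<beta>' e' < e\<close>, it is enough that
  \<open>N' \<le> \<beta>' N\<close>. But \<open>N' \<le> N + q\<close>, and \<open>\<beta>' N = N + q (1 - e') N\<close>, so what is needed is
  \<open>(1 - e') N \<ge> 1\<close>. With \<open>u = q (m + 1) e\<close>, the hypothesis \<open>q (m - 1) \<ge> 3\<close> gives \<open>N \<ge> 1 + u\<close>,
  and \<open>e' (1 + u) \<le> e (q + 2) \<le> u\<close>.\<close>

lemma eps_slope_decreasing_criterion:
  fixes q m e e' :: real
  assumes q: "1 \<le> q" and m: "2 \<le> m" and large: "3 \<le> q * (m - 1)"
    and e: "0 < e" "e < 1" "q * (m + 1) * e < q + 1"
    and e': "0 < e'" and dec: "(q + 1 - q * e') * e' < e" and ge: "4 / 3 \<le> q + 1 - q * e'"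
  shows "e' * slope q (m + 1) e' < e * slope q m e"
proof -
  define u where "u = q * (m + 1) * e"
  define u' where "u' = q * (m + 2) * e'"
  define N where "N = q * (m - 1) - 2 + u"
  define N' where "N' = q * m - 2 + u'"
  have ee: "4 / 3 * e' \<le> (q + 1 - q * e') * e'" using ge e' by (intro mult_right_mono) auto
  then have e43: "4 / 3 * e' < e" using dec by linarith
  then have less: "e' < e" using e' by linarith
  have "(m + 2) * e' \<le> (4 / 3 * (m + 1)) * e'" using m e' by (intro mult_right_mono) auto
  also have "\<dots> = (m + 1) * (4 / 3 * e')" by simp
  also have "\<dots> \<le> (m + 1) * e" using e43 m by (intro mult_left_mono) auto
  finally have uu: "u' \<le> u" using q by (simp add: u_def u'_def mult.assoc)
  have u_pos: "0 < u" using q m e by (simp add: u_def)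
  have N1: "1 + u \<le> N" using large by (simp add: N_def)
  have "1 \<le> (1 - e') * N"
  proof -
    have "e' * (1 + u) \<le> e * (q + 2)"
      using less e e' u_pos by (intro mult_mono) (auto simp: u_def)
    also have "\<dots> \<le> e * (q * (m + 1))"
    proof (rule mult_left_mono)
      have "q * 3 \<le> q * (m + 1)" using q m by (intro mult_left_mono) auto
      then show "q + 2 \<le> q * (m + 1)" using q by linarith
    qed (use e in auto)
    finally have "1 \<le> (1 - e') * (1 + u)" by (simp add: u_def algebra_simps)
    also have "\<dots> \<le> (1 - e') * N" using N1 less e by (intro mult_left_mono) auto
    finally show ?thesis .
  qed
  then have "q * 1 \<le> q * ((1 - e') * N)" using q by (intro mult_left_mono) auto
  then have NN: "N' \<le> (q + 1 - q * e') * N"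
    using uu by (simp add: N_def N'_def algebra_simps)
  have "e' * N' \<le> e' * ((q + 1 - q * e') * N)" using NN e' by (intro mult_left_mono) auto
  also have "\<dots> = ((q + 1 - q * e') * e') * N" by (simp only: mult_ac)
  also have "\<dots> < e * N" using dec N1 u_pos by (intro mult_strict_right_mono) auto
  finally have num: "e' * N' < e * N" .
  have P: "q * (1 - e) * (q + 1 - u) \<le> q * (1 - e') * (q + 1 - u')"
    using q less e uu by (intro mult_mono) (auto simp: u_def)
  have P_pos: "0 < q * (1 - e) * (q + 1 - u)" using q e by (simp add: u_def)
  have "0 \<le> e' * N'"
  proof -
    have "q * (m - 1) = q * m - q" by (simp add: algebra_simps)
    moreover have "0 \<le> u'" using q m e' by (simp add: u'_def)
    ultimately have "0 \<le> N'" using large q unfolding N'_def by linarith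
    then show ?thesis using e' by simp
  qed
  then have "e' * N' / (q * (1 - e') * (q + 1 - u')) \<le> e' * N' / (q * (1 - e) * (q + 1 - u))"
    using P P_pos by (intro divide_left_mono) auto
  also have "\<dots> < e * N / (q * (1 - e) * (q + 1 - u))"
    using num P_pos by (intro divide_strict_right_mono)
  finally show ?thesis by (simp add: slope_def N_def N'_def u_def u'_def add.assoc)
qed

lemma b_qm_less_Suc:
  assumes q: "q \<ge> 1" and m: "m \<ge> 2"
  shows "b_qm q m < b_qm q (Suc m)"
proof -
  let ?e = "eps q m" and ?e' = "eps q (Suc m)"
  note f = eps_facts[OF q m]
  have m': "Suc m \<ge> 2" using m by simp
  note f' = eps_facts[OF q m']
  have "?e' * slope q (Suc m) ?e' < ?e * slope q m ?e"
  proof (cases "3 \<le> q * (m - 1)")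
    case True
    then have "real 3 \<le> real (q * (m - 1))" by (simp only: of_nat_le_iff)
    then have large: "3 \<le> real q * (real m - 1)" using m by (simp add: of_nat_diff)
    have "4 / 3 \<le> beta_qm q (Suc m)"
      using beta_qm_gt_four_thirds[OF q m'] by simp
    then have "?e' * slope q (real m + 1) ?e' < ?e * slope q m ?e"
      using q m f f' large eps_Suc_less[OF q m] by (intro eps_slope_decreasing_criterion) auto
    then show ?thesis by (simp add: add.commute)
  next
    case False
    then consider "q = 1" "m = 2" | "q = 1" "m = 3" | "q = 2" "m = 2"
    proof -
      obtain l where l: "m = Suc (Suc l)" using m by (metis add_2_eq_Suc le_Suc_ex)
      with False have "q + q * l < 3" by simp
      moreover have "l \<le> q * l" using q by simp
      ultimately have "q < 3" "Suc l < 3" using q by linarith+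
      then show thesis using that False q l by (auto simp: less_Suc_eq numeral_eq_Suc)
    qed
    \<comment> \<open>The product of \<open>\<epsilon>\<close> and the slope increases with \<open>\<epsilon>\<close>, so now a lower bound of the old value
      and an upper bound of the new one are needed.\<close>
    then show ?thesis
    proof cases
      case 1
      have "eps 1 3 * slope 1 3 (eps 1 3) \<le> 162/1000 * slope 1 3 (162/1000)"
        using eps_numeric f' 1 by (intro slope_mono(2)) (auto simp: eval_nat_numeral)
      also have "\<dots> < 38/100 * slope 1 2 (38/100)" by (simp add: slope_def)
      also have "\<dots> \<le> eps 1 2 * slope 1 2 (eps 1 2)"
        using eps_numeric f 1 by (intro slope_mono(2)) (auto simp: eval_nat_numeral)
      finally show ?thesis using 1 by (simp add: eval_nat_numeral)
    next
      case 2
      have "eps 1 4 * slope 1 4 (eps 1 4) \<le> 725/10000 * slope 1 4 (725/10000)"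
        using eps_numeric f' 2 by (intro slope_mono(2)) (auto simp: eval_nat_numeral)
      also have "\<dots> < 16/100 * slope 1 3 (16/100)" by (simp add: slope_def)
      also have "\<dots> \<le> eps 1 3 * slope 1 3 (eps 1 3)"
        using eps_numeric f 2 by (intro slope_mono(2)) (auto simp: eval_nat_numeral)
      finally show ?thesis using 2 by (simp add: eval_nat_numeral)
    next
      case 3
      have "eps 2 3 * slope 2 3 (eps 2 3) \<le> 41/1000 * slope 2 3 (41/1000)"
        using eps_numeric f' 3 by (intro slope_mono(2)) (auto simp: eval_nat_numeral)
      also have "\<dots> < 13/100 * slope 2 2 (13/100)" by (simp add: slope_def)
      also have "\<dots> \<le> eps 2 2 * slope 2 2 (eps 2 2)"
        using eps_numeric f 3 by (intro slope_mono(2)) (auto simp: eval_nat_numeral)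
      finally show ?thesis using 3 by (simp add: eval_nat_numeral)
    qed
  qed
  then have "real q * (?e' * slope q (Suc m) ?e') < real q * (?e * slope q m ?e)"
    using q by (intro mult_strict_left_mono) auto
  then show ?thesis by (simp only: k_b_qm_eq[OF q m] k_b_qm_eq[OF q m']) simp
qed

lemma strict_mono_on_atLeast_Suc:
  fixes f :: "nat \<Rightarrow> 'a::order"
  assumes "\<And>m. m \<ge> a \<Longrightarrow> f m < f (Suc m)"
  shows "strict_mono_on {a..} f"
proof (rule strict_mono_onI)
  fix r s assume "r \<in> {a..}" "s \<in> {a..}" "r < s"
  then show "f r < f s"
    using lift_Suc_mono_less[of "\<lambda>n. f (n + a)" "r - a" "s - a"] assms by simp
qed

theorem theorem1p5:
  fixes q :: nat
  assumes "q \<ge> 1"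
  shows "strict_mono_on {2..} (k_qm q) \<and> strict_mono_on {2..} (b_qm q)"
  using strict_mono_on_atLeast_Suc k_qm_less_Suc b_qm_less_Suc assms by blast

end
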